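(* Let $\delta=1$, and let $(f,A)$ be the unique solution to $$\partial_tf+\widehat v\cdot\nabla_xf+\langle v\rangle\,\partial_{x^1}A\,\partial_{v^1}f=0,\qquad \Box A=\int_{\mathbb{R}^3_v}f\,\mathrm{d}v$$ with initial data $$A(0,x)=\Lambda\,\frac{\mathcal{A}(-|x|)}{|x|},\qquad \partial_tA(0,x)=\Lambda\,\frac{\mathcal{A}'(-|x|)}{|x|},\qquad f(0,\cdot,\cdot)=\varepsilon f_0,\quad f_0\in C^1(\mathbb{R}^3_x\times\mathbb{R}^3_v,\mathbb{R}).$$ Assume that $\Lambda$ and $\varepsilon$ are sufficiently small so that $(f,A)$ falls within the framework of the global existence theorem recalled in the context, and that $\varepsilon/\Lambda$ is sufficiently small. Then, for every $b>0$ and $W\in\mathcal{W}_b$, there exists an absolute constant $c>0$ such that $$\forall\,\tau\ge1,\qquad W\big(\langle\mathcal{V}_\tau\rangle\big)\,\big|f(\tau,\mathcal{X}_\tau,\mathcal{V}_\tau)\big|\ge\langle\tau\rangle^{2bc\Lambda}\,W(\langle\tau\rangle)\,\big|f(0,7,0,0,\tau,0,0)\big|,$$ where $(\mathcal{X}_\tau,\mathcal{V}_\tau)$ denotes the value at time $\tau$ of the characteristic that starts from $(x,v)=(7,0,0,\tau,0,0)$ at time $0$.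
   Context: Notation: $\langle z\rangle=\sqrt{1+|z|^2}$, $\widehat v=v/\langle v\rangle$, $\Box=-\partial_t^2+\Delta_x$. $\mathcal{A}\in C^3_c(\mathbb{R},\mathbb{R}_+)$ is a fixed function with $\mathcal{A}(u)=e^{-2u}$ for $u\in[-10,-1]$ and $\mathcal{A}(u)=0$ for $u\ge0$. $\mathcal{A}_{\mathrm{hom}}(t,x)=\mathcal{A}(t-|x|)/|x|$ is the associated solution of $\Box\mathcal{A}_{\mathrm{hom}}=0$. For $b>0$, $$\mathcal{W}_b=\big\{W\in C^1(\mathbb{R}_+,[1,+\infty[)\ \big|\ W(s)\to+\infty\text{ as }s\to+\infty,\ \ sW'(s)/W(s)\ge b\ \text{ for all } s\ge1\big\}.$$ Characteristics: solutions of $\dot{\mathcal{X}}=\widehat{\mathcal{V}}$, $\dot{\mathcal{V}}^1=\langle\mathcal{V}\rangle\,\partial_{x^1}A(t,\mathcal{X})$, $\dot{\mathcal{V}}^2=\dot{\mathcal{V}}^3=0$. Framework of the global existence theorem ($\delta=1$). For some $\kappa>0$, $B>0$ and $0<\bar\varepsilon\le\bar\Lambda$, where $\bar\Lambda$ is a fixed constant multiple of $\Lambda$ and $\bar\varepsilon$ a multiple of $\varepsilon$ (by a constant depending on $f_0$), the data satisfy $$\sup_{|\gamma|\le2}\sup_x\langle x\rangle^{2+|\gamma|}|\partial^\gamma_{t,x}A(0,x)|\le\bar\Lambda,\qquad \sup_{x,v}\langle x\rangle^{12}\langle v\rangle^{160}e^{B\sqrt{\bar\Lambda}\langle v\rangle^{1+\kappa}}|\nabla_{x,v}f(0,x,v)|+\langle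 x\rangle^8\langle v\rangle^{150}|f(0,x,v)|\le\bar\varepsilon,$$ with $\bar\Lambda$ and $\bar\varepsilon$ small enough and $B$ large enough, depending on $\kappa$, for the theorem to apply. In that framework the solution is global in time and there is $C_{\mathrm{stab}}>0$, independent of $\varepsilon$, such that $\langle t\rangle|\partial_{x^1}A-\Lambda\partial_{x^1}\mathcal{A}_{\mathrm{hom}}|(t,x)\le C_{\mathrm{stab}}\,\varepsilon$ for all $(t,x)$ with $1\le|x|-t\le10$. "Absolute constant" means independent of $b,W,\Lambda,\varepsilon,f_0,\tau$ ($\mathcal{A}$ being fixed). *)

theory Defs
  imports "HOL-Analysis.Analysis"
begin

definition jap :: "'a::real_normed_vector \<Rightarrow> real"
  where "jap z = sqrt (1 + (norm z)\<^sup>2)"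

definition vhat :: "real^3 \<Rightarrow> (real^3)"
  where "vhat v = (1 / jap v) *\<^sub>R v"

(* Derivative of F at z in direction e, relative to S.  The sets S used below are convex with
   nonempty interior, so the derivative within S is unique; on half-spaces {0..} \<times> ... it is
   one-sided in time at t = 0. *)
definition pd :: "'a::euclidean_space set \<Rightarrow> 'a \<Rightarrow> ('a \<Rightarrow> real) \<Rightarrow> 'a \<Rightarrow> real"
  where "pd S e F z = frechet_derivative F (at z within S) e"

primrec Ck_on :: "nat \<Rightarrow> 'a::euclidean_space set \<Rightarrow> ('a \<Rightarrow> real) \<Rightarrow> bool"
  where
    "Ck_on 0 S F \<longleftrightarrow> continuous_on S F"
  | "Ck_on (Suc k) S F \<longleftrightarrow> F differentiable_on S \<and> (\<forall>e\<in>Basis. Ck_on k S (pd S e F))"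

definition grad :: "('a::euclidean_space \<Rightarrow> real) \<Rightarrow> 'a \<Rightarrow> 'a"
  where "grad F z = (\<Sum>e\<in>Basis. pd UNIV e F z *\<^sub>R e)"

definition spacetime :: "(real \<times> (real^3)) set"
  where "spacetime = {0..} \<times> UNIV"

definition phase_spacetime :: "(real \<times> (real^3) \<times> (real^3)) set"
  where "phase_spacetime = {0..} \<times> UNIV \<times> UNIV"

definition dt :: "(real \<times> (real^3) \<Rightarrow> real) \<Rightarrow> real \<times> (real^3) \<Rightarrow> real"
  where "dt = pd spacetime (1, 0)"

definition dx :: "3 \<Rightarrow> (real \<times> (real^3) \<Rightarrow> real) \<Rightarrow> real \<times> (real^3) \<Rightarrow> real"
  where "dx i = pd spacetime (0, axis i 1)"

definition box_op :: "(real \<times> (real^3) \<Rightarrow> real) \<Rightarrow> real \<times> (real^3) \<Rightarrow> real"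
  where "box_op A z = - dt (dt A) z + (\<Sum>i\<in>UNIV. dx i (dx i A) z)"

definition profile :: "(real \<Rightarrow> real) \<Rightarrow> bool"
  where "profile a \<longleftrightarrow>
    Ck_on 3 UNIV a \<and> compact (closure {u. a u \<noteq> 0}) \<and> (\<forall>u. 0 \<le> a u) \<and>
    (\<forall>u\<in>{-10..-1}. a u = exp (- 2 * u)) \<and> (\<forall>u\<ge>0. a u = 0)"

(* For a profile a, which vanishes to third order at 0, the convention y / 0 = 0 gives the
   continuous extension of this function, and of the initial data below, to x = 0. *)
definition A_hom :: "(real \<Rightarrow> real) \<Rightarrow> real \<times> (real^3) \<Rightarrow> real"
  where "A_hom a = (\<lambda>(t, x). a (t - norm x) / norm x)"

definition weight_class :: "real \<Rightarrow> (real \<Rightarrow> real) set"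
  where "weight_class b = {W. Ck_on 1 {0..} W \<and> (\<forall>s\<ge>0. 1 \<le> W s) \<and>
    filterlim W at_top at_top \<and> (\<forall>s\<ge>1. s * deriv W s / W s \<ge> b)}"

(* Global classical solutions, f being C^1 and A being C^2 up to t = 0. *)
definition solution ::
  "(real \<times> (real^3) \<times> (real^3) \<Rightarrow> real) \<Rightarrow> (real \<times> (real^3) \<Rightarrow> real) \<Rightarrow> bool"
  where "solution f A \<longleftrightarrow>
    Ck_on 1 phase_spacetime f \<and> Ck_on 2 spacetime A \<and>
    (\<forall>t\<ge>0. \<forall>x v.
      pd phase_spacetime (1, 0, 0) f (t, x, v)
      + (\<Sum>i\<in>UNIV. vhat v $ i * pd phase_spacetime (0, axis i 1, 0) f (t, x, v))
      + jap v * dx 1 A (t, x) * pd phase_spacetime (0, 0, axis 1 1) f (t, x, v) = 0) \<and>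
    (\<forall>t\<ge>0. \<forall>x.
      integrable lborel (\<lambda>v. f (t, x, v)) \<and>
      box_op A (t, x) = (LINT v|lborel. f (t, x, v)))"

definition initial_data ::
  "(real \<Rightarrow> real) \<Rightarrow> real \<Rightarrow> real \<Rightarrow> ((real^3) \<times> (real^3) \<Rightarrow> real) \<Rightarrow>
   (real \<times> (real^3) \<times> (real^3) \<Rightarrow> real) \<Rightarrow> (real \<times> (real^3) \<Rightarrow> real) \<Rightarrow> bool"
  where "initial_data a \<Lambda> \<epsilon> f0 f A \<longleftrightarrow>
    (\<forall>x. A (0, x) = \<Lambda> * (a (- norm x) / norm x)) \<and>
    (\<forall>x. dt A (0, x) = \<Lambda> * (deriv a (- norm x) / norm x)) \<and>
    (\<forall>x v. f (0, x, v) = \<epsilon> * f0 (x, v))"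

(* The derivatives of order |\<gamma>| are indexed by lists of |\<gamma>| coordinate directions of
   spacetime, the time direction included. *)
definition data_bounds ::
  "real \<Rightarrow> real \<Rightarrow> real \<Rightarrow> real \<Rightarrow>
   (real \<times> (real^3) \<times> (real^3) \<Rightarrow> real) \<Rightarrow> (real \<times> (real^3) \<Rightarrow> real) \<Rightarrow> bool"
  where "data_bounds \<kappa> B Lb eb f A \<longleftrightarrow>
    (\<forall>ds x. set ds \<subseteq> Basis \<and> length ds \<le> 2 \<longrightarrow>
      jap x ^ (2 + length ds) * \<bar>foldr (pd spacetime) ds A (0, x)\<bar> \<le> Lb) \<and>
    (\<forall>x v.
      jap x ^ 12 * jap v ^ 160 * exp (B * sqrt Lb * jap v powr (1 + \<kappa>))
        * norm (grad (\<lambda>(y, w). f (0, y, w)) (x, v))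
      + jap x ^ 8 * jap v ^ 150 * \<bar>f (0, x, v)\<bar> \<le> eb)"

definition stability ::
  "(real \<Rightarrow> real) \<Rightarrow> real \<Rightarrow> real \<Rightarrow> real \<Rightarrow> (real \<times> (real^3) \<Rightarrow> real) \<Rightarrow> bool"
  where "stability a \<Lambda> \<epsilon> C A \<longleftrightarrow>
    (\<forall>t\<ge>0. \<forall>x. 1 \<le> norm x - t \<and> norm x - t \<le> 10 \<longrightarrow>
      jap t * \<bar>dx 1 A (t, x) - \<Lambda> * dx 1 (A_hom a) (t, x)\<bar> \<le> C * \<epsilon>)"

(* For a global solution (f, A): being in the regime of the global existence theorem.  The
   thresholds for Lb, eb and B in that theorem are not explicit; that they are met enters through
   what the theorem then provides, the stability estimate.  That C does not depend on \<epsilon> has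
   to be expressed by the order of quantifiers wherever this predicate is used. *)
definition in_framework ::
  "(real \<Rightarrow> real) \<Rightarrow> real \<Rightarrow> real \<Rightarrow> real \<Rightarrow> real \<Rightarrow> real \<Rightarrow> real \<Rightarrow> real \<Rightarrow>
   (real \<times> (real^3) \<times> (real^3) \<Rightarrow> real) \<Rightarrow> (real \<times> (real^3) \<Rightarrow> real) \<Rightarrow> bool"
  where "in_framework a \<Lambda> \<epsilon> \<kappa> B Lb eb C f A \<longleftrightarrow>
    0 < \<kappa> \<and> 0 < B \<and> 0 < eb \<and> eb \<le> Lb \<and>
    data_bounds \<kappa> B Lb eb f A \<and> stability a \<Lambda> \<epsilon> C A"

definition characteristic ::
  "(real \<times> (real^3) \<Rightarrow> real) \<Rightarrow> real \<Rightarrow> (real \<Rightarrow> (real^3)) \<Rightarrow> (real \<Rightarrow> (real^3)) \<Rightarrow> bool"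
  where "characteristic A T X V \<longleftrightarrow> (\<forall>t\<in>{0..T}.
    (X has_vector_derivative vhat (V t)) (at t within {0..T}) \<and>
    ((\<lambda>s. V s $ 1) has_real_derivative jap (V t) * dx 1 A (t, X t)) (at t within {0..T}) \<and>
    ((\<lambda>s. V s $ 2) has_real_derivative 0) (at t within {0..T}) \<and>
    ((\<lambda>s. V s $ 3) has_real_derivative 0) (at t within {0..T}))"

end

theory Submission imports Defs begin

text \<open>
  The weight grows along one well-chosen characteristic because the particle on it almost keeps
  pace with the outgoing linear wave and is accelerated by it all the time. It starts on the first coordinate axis with momentum along that
  axis, so it stays on the axis (\<open>characteristic_on_axis\<close>) and its motion is described by the
  scalars \<open>r = X\<^sub>1\<close> and \<open>p = V\<^sub>1\<close>, with \<open>r' = p / jap p\<close> and \<open>p' = jap p * E\<close>, where \<open>E\<close> is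
  the value of \<open>dx 1 A\<close> at the particle.

  In the strip \<open>6 \<le> r - t \<le> 7\<close> the profile is the explicit exponential, so the derivative of the
  homogeneous wave is at least \<open>1 / (8 * jap t)\<close> (\<open>dx1_A_hom_lower_bound\<close>). By the stability
  estimate, the field \<open>E\<close> is then at least \<open>\<Lambda> / (16 * jap t)\<close>, once \<open>\<epsilon> / \<Lambda>\<close> is small compared
  with \<open>1 / C\<close>. The particle stays in this strip up to time \<open>\<tau>\<close>: while it is there, the
  momentum does not fall below its initial value \<open>\<tau>\<close>, so the speed differs from \<open>1\<close> by at most
  \<open>1 / (2 * \<tau>)\<close> and the loss in \<open>r - t\<close> up to time \<open>\<tau>\<close> is at most \<open>1 / 2\<close>. This is a
  bootstrap argument, carried out in \<open>momentum_growth\<close>. A field of size \<open>k / jap t\<close> makes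
  \<open>ln (jap p)\<close> grow at rate at least \<open>k / (2 * jap t)\<close>, and \<open>1 / jap t\<close> is the derivative of
  \<open>ln (t + jap t)\<close>; hence \<open>jap (V \<tau>)\<close> is at least \<open>jap \<tau>\<close> times the power
  \<open>jap \<tau> powr (\<Lambda> / 32)\<close>.

  A weight in the class \<open>weight_class b\<close> grows at least like the power \<open>b\<close> (\<open>weight_growth\<close>), which
  turns this gain of momentum into the factor \<open>jap \<tau> powr (b * \<Lambda> / 32)\<close>, that is \<open>c = 1 / 64\<close>.
  The density itself is constant along the characteristic
  (\<open>density_constant_on_characteristic\<close>).
\<close>

section \<open>Monotone functions and barriers on an interval\<close>

lemma nondecreasing_if_deriv_nonneg:
  fixes g g' :: "real \<Rightarrow> real"
  assumes deriv: "\<And>u. u \<in> {a..b} \<Longrightarrow> (g has_real_derivative g' u) (at u within {a..b})"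
    and nonneg: "\<And>u. u \<in> {a<..<b} \<Longrightarrow> 0 \<le> g' u"
    and "a \<le> b"
  shows "g a \<le> g b"
proof (rule DERIV_nonneg_imp_increasing_open[OF \<open>a \<le> b\<close>])
  show "\<exists>y. (g has_real_derivative y) (at x) \<and> 0 \<le> y" if "a < x" "x < b" for x
    using deriv[of x] nonneg[of x] that by (auto simp: at_within_Icc_at)
  show "continuous_on {a..b} g"
    using deriv by (rule DERIV_continuous_on)
qed

lemma constant_if_deriv_zero:
  fixes g :: "real \<Rightarrow> real"
  assumes "\<And>u. u \<in> {0..T} \<Longrightarrow> (g has_real_derivative 0) (at u within {0..T})"
    and "t \<in> {0..T}"
  shows "g t = g 0"
proof -
  obtain c where "\<forall>u\<in>{0..T}. g u = c"
    using has_field_derivative_zero_constant[OF _ assms(1)] by (auto simp: convex_real_interval)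
  then show ?thesis using assms(2) by auto
qed

text \<open>The continuity method: at the first time when \<open>g\<close> takes the value \<open>m\<close>, the bound \<open>m \<le> g\<close> has
  held so far, so the hypothesis \<open>step\<close> gives the strict bound at that very time.\<close>
lemma continuous_barrier:
  fixes g :: "real \<Rightarrow> real"
  assumes cont: "continuous_on {0..T} g" and start: "m < g 0"
    and step: "\<And>t. t \<in> {0..T} \<Longrightarrow> (\<And>s. s \<in> {0..t} \<Longrightarrow> m \<le> g s) \<Longrightarrow> m < g t"
    and t: "t \<in> {0..T}"
  shows "m < g t"
proof (rule ccontr)
  assume "\<not> m < g t"
  define S where "S = {0..T} \<inter> g -` {m}"
  have reach: "\<exists>u\<in>S. u \<le> s" if "s \<in> {0..T}" "g s \<le> m" for s
  proof -
    have "continuous_on {0..s} g"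
      using cont that by (auto intro: continuous_on_subset)
    then have "\<exists>u\<ge>0. u \<le> s \<and> g u = m"
      using IVT2'[of g s m 0] that start by simp
    then obtain u where "0 \<le> u" "u \<le> s" "g u = m" by blast
    then show ?thesis using that by (auto simp: S_def)
  qed
  have "closed S"
    unfolding S_def using cont by (rule continuous_closed_preimage) simp_all
  moreover have "bounded S"
    unfolding S_def by (rule bounded_subset[OF bounded_closed_interval]) blast
  ultimately have "compact S"
    by (simp add: compact_eq_bounded_closed)
  moreover have "S \<noteq> {}"
    using reach[of t] t \<open>\<not> m < g t\<close> by auto
  ultimately obtain u where u: "u \<in> S" and least: "\<And>s. s \<in> S \<Longrightarrow> u \<le> s"
    using compact_attains_inf by meson
  have "m \<le> g s" if "s \<in> {0..u}" for s
  proof (rule ccontr)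
    assume "\<not> m \<le> g s"
    moreover have "s \<in> {0..T}" using that u by (auto simp: S_def)
    ultimately obtain w where "w \<in> S" "w \<le> s"
      using reach[of s] by force
    then have "s = u" using least[of w] that by auto
    then show False using u \<open>\<not> m \<le> g s\<close> by (auto simp: S_def)
  qed
  then show False using step[of u] u by (auto simp: S_def)
qed

section \<open>The Japanese bracket\<close>

lemma jap_pos: "jap z > 0"
  by (simp add: jap_def add_pos_nonneg)

lemma jap_ge_1: "jap z \<ge> 1"
  by (simp add: jap_def)

lemma abs_le_jap: "\<bar>x\<bar> \<le> jap (x::real)"
  by (simp add: jap_def real_le_rsqrt)

lemma jap_real: "jap (x::real) = sqrt (1 + x\<^sup>2)"
  by (simp add: jap_def)

lemma jap_power2: "(jap z)\<^sup>2 = 1 + (norm z)\<^sup>2"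
  by (simp add: jap_def add_nonneg_nonneg)

lemma jap_has_real_derivative:
  assumes "(p has_real_derivative p') (at t within S)"
  shows "((\<lambda>s. jap (p s)) has_real_derivative p t * p' / jap (p t)) (at t within S)"
proof -
  have "((\<lambda>s. 1 + (p s)\<^sup>2) has_real_derivative 2 * p t * p') (at t within S)"
    by (auto intro!: derivative_eq_intros assms)
  moreover have "(sqrt has_real_derivative inverse (sqrt (1 + (p t)\<^sup>2)) / 2) (at (1 + (p t)\<^sup>2))"
    by (rule DERIV_real_sqrt) (simp add: add_pos_nonneg)
  ultimately show ?thesis
    unfolding jap_real using DERIV_chain2 by (fastforce simp: field_simps)
qed

section \<open>The homogeneous wave near the characteristic\<close>

text \<open>\<open>pd\<close> evaluates a Frechet derivative that is picked by choice. The chain rule holds for whichever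
  one is picked, so along a line that stays inside \<open>S\<close> its value is an ordinary derivative in
  one variable, which is unique. Spatial lines stay inside the half-space of nonnegative times,
  even at time zero.\<close>
lemma pd_eq_line_deriv:
  assumes diff: "F differentiable (at z within S)"
    and line: "\<And>s. z + s *\<^sub>R e \<in> S"
  shows "((\<lambda>s. F (z + s *\<^sub>R e)) has_real_derivative pd S e F z) (at 0)"
proof -
  have D: "(F has_derivative frechet_derivative F (at z within S)) (at z within S)"
    using diff frechet_derivative_works by blast
  have L: "((\<lambda>s. z + s *\<^sub>R e) has_derivative (\<lambda>s. s *\<^sub>R e)) (at 0)"
    by (auto intro!: derivative_eq_intros)
  have "((F \<circ> (\<lambda>s. z + s *\<^sub>R e)) has_derivative
      (frechet_derivative F (at z within S) \<circ> (\<lambda>s. s *\<^sub>R e))) (at 0 within UNIV)"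
    by (rule diff_chain_within[OF L])
      (use line in \<open>auto intro: has_derivative_subset[OF D]\<close>)
  moreover have "frechet_derivative F (at z within S) (s *\<^sub>R e) = pd S e F z * s" for s
    using has_derivative_linear[OF D] by (simp add: pd_def linear_scale)
  ultimately show ?thesis
    by (simp add: has_field_derivative_def o_def)
qed

text \<open>On the positive axis the wave is \<open>a (t - r) / r\<close>, and the derivative is that of the quotient.
  Differentiability in all variables, for \<open>r > 0\<close>, is what gives meaning to \<open>dx\<close>.\<close>
lemma dx1_A_hom:
  assumes a: "a differentiable (at (t - r))" and t: "0 \<le> t" and r: "0 < r"
  shows "dx 1 (A_hom a) (t, r *\<^sub>R axis 1 1) = - deriv a (t - r) / r - a (t - r) / r\<^sup>2"
proof -
  let ?z = "(t, r *\<^sub>R axis 1 1) :: real \<times> (real^3)"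
  have n: "norm (x *\<^sub>R axis 1 1 :: real^3) = \<bar>x\<bar>" for x by simp
  have N: "(\<lambda>y::real \<times> (real^3). norm (snd y)) differentiable (at ?z)"
    by (rule differentiable_chain_at[of snd ?z norm, unfolded o_def])
      (use r in \<open>auto intro!: differentiable_norm_at bounded_linear_imp_differentiable bounded_linear_snd simp: axis_eq_0_iff\<close>)
  have "(\<lambda>y::real \<times> (real^3). a (fst y - norm (snd y))) differentiable (at ?z)"
    by (rule differentiable_chain_at[of "\<lambda>y. fst y - norm (snd y)" ?z a, unfolded o_def])
      (use r a in \<open>auto intro!: differentiable_diff N bounded_linear_imp_differentiable[OF bounded_linear_fst]\<close>)
  then have "(\<lambda>y::real \<times> (real^3). a (fst y - norm (snd y)) / norm (snd y)) differentiable (at ?z)"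
    by (rule differentiable_divide) (use N r in \<open>auto simp: axis_eq_0_iff\<close>)
  then have diff: "A_hom a differentiable (at ?z within spacetime)"
    by (auto simp: A_hom_def case_prod_unfold intro: differentiable_at_withinI)
  have "((\<lambda>s. A_hom a (?z + s *\<^sub>R (0, axis 1 1))) has_real_derivative dx 1 (A_hom a) ?z) (at 0)"
    unfolding dx_def by (rule pd_eq_line_deriv[OF diff]) (use t in \<open>auto simp: spacetime_def\<close>)
  moreover have "A_hom a (?z + s *\<^sub>R (0, axis 1 1)) = a (t - \<bar>r + s\<bar>) / \<bar>r + s\<bar>" for s
    by (simp add: A_hom_def n flip: scaleR_add_left)
  ultimately have 1: "((\<lambda>s. a (t - \<bar>r + s\<bar>) / \<bar>r + s\<bar>) has_real_derivative dx 1 (A_hom a) ?z) (at 0)"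
    by simp
  have a': "(a has_real_derivative deriv a (t - r)) (at (t - r))"
    using a by (simp add: DERIV_deriv_iff_real_differentiable)
  have ac: "((\<lambda>s. a (t - (r + s))) has_real_derivative deriv a (t - r) * (- 1)) (at 0)"
    by (rule DERIV_chain2[where f = a]) (use a' in \<open>auto intro!: derivative_eq_intros\<close>)
  have 2: "((\<lambda>s. a (t - (r + s)) / (r + s)) has_real_derivative
      - deriv a (t - r) / r - a (t - r) / r\<^sup>2) (at 0)"
    by (rule derivative_eq_intros ac refl)+ (use r in \<open>auto simp: field_simps power2_eq_square\<close>)
  have "((\<lambda>s. a (t - \<bar>r + s\<bar>) / \<bar>r + s\<bar>) has_real_derivative
      - deriv a (t - r) / r - a (t - r) / r\<^sup>2) (at 0)"
    by (rule has_field_derivative_transform_within[OF 2 r]) (simp_all add: dist_real_def)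
  with 1 show ?thesis using DERIV_unique by blast
qed

text \<open>The formula for \<open>a\<close> determines its derivative only in the interior of the interval on which
  it is given.\<close>
lemma profile_near_exponential:
  assumes "profile a" and u: "u \<in> {-10<..<-1}"
  shows "a differentiable (at u)" "a u = exp (- 2 * u)" "deriv a u = - 2 * exp (- 2 * u)"
proof -
  have e: "a w = exp (- 2 * w)" if "w \<in> {-10<..<-1}" for w
    using assms(1) that by (auto simp: profile_def)
  have "((\<lambda>w. exp (- 2 * w)) has_real_derivative - 2 * exp (- 2 * u)) (at u)"
    by (auto intro!: derivative_eq_intros)
  then have D: "(a has_real_derivative - 2 * exp (- 2 * u)) (at u)"
    by (rule has_field_derivative_transform_within_open[where S = "{-10<..<-1}"])
      (use u e in auto)
  show "a differentiable (at u)" using D real_differentiable_def by blast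
  show "a u = exp (- 2 * u)" using e u by simp
  show "deriv a u = - 2 * exp (- 2 * u)" using D by (rule DERIV_imp_deriv)
qed

text \<open>With \<open>a' = - 2 * a\<close> the derivative equals \<open>a (t - r) * (2 / r - 1 / r\<^sup>2)\<close>, so the term that
  comes from the decay factor \<open>1 / r\<close> is dominated as soon as \<open>r \<ge> 1\<close>. The exponential is
  estimated from below by \<open>1\<close>, and \<open>r \<le> t + 7 \<le> 8 * jap t\<close>. The strip is the one that the
  characteristic visits, and lies well inside the region where \<open>a\<close> is the exponential.\<close>
lemma dx1_A_hom_lower_bound:
  assumes "profile a" "0 \<le> t" and r: "6 \<le> r - t" "r - t \<le> 7"
  shows "1 / 8 \<le> jap t * dx 1 (A_hom a) (t, r *\<^sub>R axis 1 1)"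
proof -
  have u: "t - r \<in> {-10<..<-1}" and r1: "r \<ge> 1" using assms by auto
  note p = profile_near_exponential[OF assms(1) u]
  have "1 / r \<le> 2 / r - 1 / r\<^sup>2"
    using r1 by (simp add: field_simps power2_eq_square)
  also have "\<dots> \<le> exp (- 2 * (t - r)) * (2 / r - 1 / r\<^sup>2)"
    using r calculation r1 order_trans[of 0 "1/r" "2 / r - 1 / r\<^sup>2"]
    by (intro mult_le_cancel_right1[THEN iffD2]) auto
  also have "\<dots> = dx 1 (A_hom a) (t, r *\<^sub>R axis 1 1)"
    using p r1 assms(2) by (subst dx1_A_hom) (auto simp: field_simps)
  finally have "1 / r \<le> dx 1 (A_hom a) (t, r *\<^sub>R axis 1 1)" .
  moreover have "r \<le> 8 * jap t"
    using abs_le_jap[of t] jap_ge_1[of t] r by auto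
  then have "1 / 8 \<le> jap t * (1 / r)" using r1 by (simp add: field_simps)
  ultimately show ?thesis
    by (meson jap_pos less_imp_le mult_left_mono order_trans)
qed

section \<open>Growth of the weight\<close>

text \<open>The condition on \<open>s * deriv W s / W s\<close> says that \<open>ln (W s) - b * ln s\<close> is nondecreasing
  on \<open>{1..}\<close>.\<close>
lemma weight_growth:
  assumes W: "W \<in> weight_class b" and s: "1 \<le> s1" "s1 \<le> s2"
  shows "(s2 / s1) powr b * W s1 \<le> W s2"
proof -
  have Wpos: "W s > 0" if "s \<ge> 0" for s
    using W that unfolding weight_class_def by (force intro: less_le_trans[of 0 1])
  have D: "(W has_real_derivative deriv W s) (at s)" if "s \<ge> 1" for s
  proof -
    have "W differentiable (at s within {0..})"
      using W that by (auto simp: weight_class_def differentiable_on_def)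
    moreover have "at s within {0..} = at s"
      using that by (intro at_within_interior) auto
    ultimately show ?thesis by (simp add: DERIV_deriv_iff_real_differentiable)
  qed
  define g where "g s = ln (W s) - b * ln s" for s
  have "g s1 \<le> g s2"
  proof (rule nondecreasing_if_deriv_nonneg[of s1 s2 g "\<lambda>u. deriv W u / W u - b / u", OF _ _ s(2)])
    fix u assume "u \<in> {s1..s2}"
    then have u: "u \<ge> 1" using s by auto
    show "(g has_real_derivative deriv W u / W u - b / u) (at u within {s1..s2})"
      unfolding g_def
      using u Wpos[of u]
      by (auto intro!: derivative_eq_intros has_field_derivative_at_within[OF D[OF u]])
  next
    fix u assume "u \<in> {s1<..<s2}"
    then have u: "u \<ge> 1" using s by auto
    then have "b \<le> u * deriv W u / W u" using W by (auto simp: weight_class_def)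
    then show "0 \<le> deriv W u / W u - b / u" using u by (simp add: field_simps)
  qed
  then have "b * ln (s2 / s1) + ln (W s1) \<le> ln (W s2)"
    using s by (simp add: g_def ln_div algebra_simps)
  then have "exp (b * ln (s2 / s1) + ln (W s1)) \<le> exp (ln (W s2))" by simp
  then show ?thesis
    using s Wpos[of s1] Wpos[of s2] by (simp add: exp_add powr_def)
qed

section \<open>Growth of the momentum\<close>

text \<open>The number \<open>T\<close> is both the initial momentum and the length of the time interval. This
  matters: a momentum of size at least \<open>T\<close> makes the speed at least \<open>1 - 1 / (2 * T)\<close>, so over
  the whole interval the particle falls behind the light ray issued from its starting point by
  at most \<open>1 / 2\<close>, and it never leaves the region where \<open>E\<close> is known to be large.\<close>
lemma momentum_growth:
  fixes r p E :: "real \<Rightarrow> real"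
  assumes r: "\<And>t. t \<in> {0..T} \<Longrightarrow> (r has_real_derivative p t / jap (p t)) (at t within {0..T})"
    and p: "\<And>t. t \<in> {0..T} \<Longrightarrow> (p has_real_derivative jap (p t) * E t) (at t within {0..T})"
    and E: "\<And>t. t \<in> {0..T} \<Longrightarrow> 6 \<le> r t - t \<Longrightarrow> r t - t \<le> 7 \<Longrightarrow> k \<le> jap t * E t"
    and r0: "r 0 = 7" and p0: "p 0 = T" and T: "1 \<le> T" and k: "0 \<le> k"
  shows "jap T powr (1 + k / 2) \<le> jap (p T)"
proof -
  \<comment> \<open>The speed is less than \<open>1\<close>.\<close>
  have upper: "r t - t \<le> 7" if "t \<in> {0..T}" for t
  proof -
    have "(0 - r 0) \<le> t - r t"
    proof (rule nondecreasing_if_deriv_nonneg[of 0 t "\<lambda>t. t - r t" "\<lambda>u. 1 - p u / jap (p u)"])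
      show "((\<lambda>t. t - r t) has_real_derivative 1 - p u / jap (p u)) (at u within {0..t})"
        if "u \<in> {0..t}" for u
        using that \<open>t \<in> {0..T}\<close>
        by (intro derivative_intros DERIV_subset[OF r]) auto
      show "0 \<le> 1 - p u / jap (p u)" for u
        using abs_le_jap[of "p u"] jap_pos[of "p u"] by (simp add: field_simps)
    qed (use that in auto)
    then show ?thesis using r0 by simp
  qed
  have p_ge: "T \<le> p t" if t: "t \<in> {0..T}" and near: "\<And>s. s \<in> {0..t} \<Longrightarrow> 6 \<le> r s - s" for t
  proof -
    have "p 0 \<le> p t"
    proof (rule nondecreasing_if_deriv_nonneg[of 0 t p "\<lambda>u. jap (p u) * E u"])
      show "(p has_real_derivative jap (p u) * E u) (at u within {0..t})" if "u \<in> {0..t}" for u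
        using that t by (intro DERIV_subset[OF p]) auto
      show "0 \<le> jap (p u) * E u" if "u \<in> {0<..<t}" for u
      proof -
        have "k \<le> jap u * E u" using that t by (intro E near upper) auto
        then have "0 \<le> E u" using k jap_pos[of u] by (smt (verit) mult_pos_neg)
        then show ?thesis using jap_pos[of "p u"] by simp
      qed
    qed (use t in auto)
    then show ?thesis using p0 by simp
  qed
  have lower: "6 < r t - t" if "t \<in> {0..T}" for t
  proof (rule continuous_barrier[where g = "\<lambda>t. r t - t", OF _ _ _ that])
    show "continuous_on {0..T} (\<lambda>t. r t - t)"
      by (intro continuous_intros DERIV_continuous_on[OF r])
    show "6 < r 0 - 0" using r0 by simp
  next
    fix t assume t: "t \<in> {0..T}" and near: "\<And>s. s \<in> {0..t} \<Longrightarrow> 6 \<le> r s - s"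
    have "r 0 - (1 - 1 / (2 * T)) * 0 \<le> r t - (1 - 1 / (2 * T)) * t"
    proof (rule nondecreasing_if_deriv_nonneg[of 0 t "\<lambda>t. r t - (1 - 1 / (2 * T)) * t"
          "\<lambda>u. p u / jap (p u) - (1 - 1 / (2 * T))"])
      show "((\<lambda>t. r t - (1 - 1 / (2 * T)) * t) has_real_derivative
          p u / jap (p u) - (1 - 1 / (2 * T))) (at u within {0..t})" if "u \<in> {0..t}" for u
      proof -
        have "(r has_real_derivative p u / jap (p u)) (at u within {0..t})"
          using that t by (intro DERIV_subset[OF r]) auto
        then show ?thesis using DERIV_cmult_Id by (rule DERIV_diff)
      qed
      show "0 \<le> p u / jap (p u) - (1 - 1 / (2 * T))" if "u \<in> {0<..<t}" for u
      proof -
        have pu: "T \<le> p u" using that t by (intro p_ge near) auto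
        \<comment> \<open>The speed deficit, from \<open>(jap p - p) * (jap p + p) = 1\<close> and \<open>jap p + p \<ge> 2 * T\<close>.\<close>
        have "1 = (jap (p u) - p u) * (jap (p u) + p u)"
          using jap_power2[of "p u"] by (simp add: power2_eq_square algebra_simps)
        also have "\<dots> \<ge> (jap (p u) - p u) * (2 * T)"
          using pu abs_le_jap[of "p u"] by (intro mult_left_mono) auto
        finally have "(jap (p u) - p u) * (2 * T) \<le> jap (p u)"
          using jap_ge_1[of "p u"] by linarith
        then have "jap (p u) - p u \<le> jap (p u) / (2 * T)"
          using T by (simp add: field_simps)
        then have "(1 - 1 / (2 * T)) * jap (p u) \<le> p u"
          by (simp add: left_diff_distrib)
        then show ?thesis using jap_pos[of "p u"] by (simp add: pos_le_divide_eq)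
      qed
    qed (use t in auto)
    then have "7 - t / (2 * T) \<le> r t - t" using r0 by (simp add: algebra_simps)
    moreover have "t / (2 * T) \<le> 1 / 2" using t T by (simp add: field_simps)
    ultimately show "6 < r t - t" by linarith
  qed
  have arg_pos: "0 < t + jap t" if "0 \<le> t" for t :: real
    using jap_pos[of t] that by linarith
  \<comment> \<open>\<open>ln (t + jap t)\<close> is the inverse hyperbolic sine, a primitive of \<open>1 / jap t\<close>.\<close>
  define g where "g t = ln (jap (p t)) - (k / 2) * ln (t + jap t)" for t
  have "g 0 \<le> g T"
  proof (rule nondecreasing_if_deriv_nonneg[of 0 T g
        "\<lambda>u. p u * E u / jap (p u) - (k / 2) * (1 / jap u)"])
    fix u assume u: "u \<in> {0..T}"
    have 1: "((\<lambda>t. ln (jap (p t))) has_real_derivative p u * E u / jap (p u)) (at u within {0..T})"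
      by (rule derivative_eq_intros jap_has_real_derivative[OF p[OF u]] jap_pos refl)+
        (use jap_pos[of "p u"] in \<open>simp add: field_simps\<close>)
    have "((\<lambda>t. ln (t + jap t)) has_real_derivative (1 + u * 1 / jap u) / (u + jap u))
        (at u within {0..T})"
      using u arg_pos[of u]
      by (auto intro!: derivative_eq_intros jap_has_real_derivative)
    moreover have "(1 + u * 1 / jap u) / (u + jap u) = 1 / jap u"
    proof -
      have "1 + u * 1 / jap u = (u + jap u) / jap u"
        using jap_pos[of u] by (simp add: field_simps)
      then show ?thesis using u arg_pos[of u] by simp
    qed
    ultimately have 2: "((\<lambda>t. ln (t + jap t)) has_real_derivative 1 / jap u) (at u within {0..T})"
      by simp
    show "(g has_real_derivative p u * E u / jap (p u) - (k / 2) * (1 / jap u)) (at u within {0..T})"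
      unfolding g_def by (intro DERIV_diff DERIV_cmult 1 2)
  next
    fix u assume u: "u \<in> {0<..<T}"
    then have pu: "1 \<le> p u" using p_ge[of u] lower T by fastforce
    have "k \<le> jap u * E u" using u lower[of u] upper[of u] by (intro E) auto
    then have E': "k / jap u \<le> E u" using jap_pos[of u] by (simp add: field_simps)
    \<comment> \<open>Since \<open>p u \<ge> 1\<close>, the speed is bounded below, here by \<open>1 / 2\<close>.\<close>
    have "1 \<le> (p u)\<^sup>2" using pu by (rule one_le_power)
    moreover have "(2 * p u)\<^sup>2 = 4 * (p u)\<^sup>2" by (simp add: power_mult_distrib)
    ultimately have "1 + (p u)\<^sup>2 \<le> (2 * p u)\<^sup>2" by linarith
    then have "jap (p u) \<le> 2 * p u"
      unfolding jap_real using pu by (intro real_le_lsqrt) auto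
    then have half: "1 / 2 \<le> p u / jap (p u)" using jap_pos[of "p u"] by (simp add: field_simps)
    have "1 / 2 * (k / jap u) \<le> p u / jap (p u) * E u"
      using k jap_pos[of u] half pu jap_pos[of "p u"] by (intro mult_mono E' half) auto
    then show "0 \<le> p u * E u / jap (p u) - (k / 2) * (1 / jap u)" by simp
  qed (use T in simp)
  then have "ln (jap T) + (k / 2) * ln (T + jap T) \<le> ln (jap (p T))"
    using p0 by (simp add: g_def jap_real)
  moreover have "(k / 2) * ln (jap T) \<le> (k / 2) * ln (T + jap T)"
    using k T jap_pos[of T] by (intro mult_left_mono) auto
  ultimately have "(1 + k / 2) * ln (jap T) \<le> ln (jap (p T))"
    by (simp add: algebra_simps)
  then have "exp ((1 + k / 2) * ln (jap T)) \<le> exp (ln (jap (p T)))" by simp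
  then show ?thesis using jap_pos[of T] jap_pos[of "p T"] by (simp add: powr_def)
qed

section \<open>The characteristic and the density along it\<close>

text \<open>The force acts along the first axis only, so the transversal momentum keeps its value zero,
  and then so does the transversal position.\<close>
lemma characteristic_on_axis:
  assumes ch: "characteristic A T X V" and t: "t \<in> {0..T}"
    and X0: "X 0 = x0 *\<^sub>R axis 1 1" and V0: "V 0 = v0 *\<^sub>R axis 1 1"
  shows "X t = (X t $ 1) *\<^sub>R axis 1 1" "V t = (V t $ 1) *\<^sub>R axis 1 1"
proof -
  have V: "V s $ 2 = 0" "V s $ 3 = 0" if "s \<in> {0..T}" for s
    using constant_if_deriv_zero[of T "\<lambda>s. V s $ 2" s]
      constant_if_deriv_zero[of T "\<lambda>s. V s $ 3" s] ch that V0
    by (auto simp: characteristic_def axis_def)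
  have Xi: "((\<lambda>s. X s $ i) has_real_derivative vhat (V s) $ i) (at s within {0..T})"
    if "s \<in> {0..T}" for s i
    using ch that by (auto simp: characteristic_def has_real_derivative_iff_has_vector_derivative
        intro: bounded_linear.has_vector_derivative[OF bounded_linear_vec_nth])
  have "X t $ 2 = X 0 $ 2"
    by (rule constant_if_deriv_zero[OF _ t]) (use Xi[of _ 2] V in \<open>simp add: vhat_def\<close>)
  moreover have "X t $ 3 = X 0 $ 3"
    by (rule constant_if_deriv_zero[OF _ t]) (use Xi[of _ 3] V in \<open>simp add: vhat_def\<close>)
  ultimately show "X t = (X t $ 1) *\<^sub>R axis 1 1" "V t = (V t $ 1) *\<^sub>R axis 1 1"
    using V[OF t] X0 by (auto simp: vec_eq_iff axis_def forall_3)
qed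

text \<open>The transport equation is the statement that the derivative of \<open>f\<close> vanishes in the direction
  \<open>(1, X', V')\<close>. Here the partial derivatives are the values of one linear map, because \<open>f\<close> is
  differentiable within the half-space of nonnegative times; the curve does not leave it, so the
  chain rule within this set applies at time zero as well.\<close>
lemma density_constant_on_characteristic:
  assumes sol: "solution f A" and ch: "characteristic A T X V" and t: "t \<in> {0..T}"
  shows "f (t, X t, V t) = f (0, X 0, V 0)"
proof (rule constant_if_deriv_zero[of T "\<lambda>t. f (t, X t, V t)"])
  fix s assume s: "s \<in> {0..T}"
  define q where "q = jap (V s) * dx 1 A (s, X s)"
  define D where "D = frechet_derivative f (at (s, X s, V s) within phase_spacetime)"
  have D: "(f has_derivative D) (at (s, X s, V s) within phase_spacetime)"
    using sol s unfolding D_def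
    by (auto simp: solution_def differentiable_on_def phase_spacetime_def
        frechet_derivative_works[symmetric])
  have V: "(V has_vector_derivative q *\<^sub>R axis 1 1) (at s within {0..T})"
  proof -
    have comp: "((\<lambda>s. V s $ i) has_real_derivative (q *\<^sub>R axis 1 1 :: real^3) $ i) (at s within {0..T})" for i
      using ch s exhaust_3[of i] by (auto simp: characteristic_def q_def axis_def)
    show ?thesis
      unfolding has_vector_derivative_def
    proof (subst has_derivative_componentwise_within, intro ballI)
      fix e :: "real^3" assume "e \<in> Basis"
      then obtain i where e: "e = axis i 1" by (auto simp: Basis_vec_def)
      show "((\<lambda>x. V x \<bullet> e) has_derivative (\<lambda>x. x *\<^sub>R q *\<^sub>R axis 1 1 \<bullet> e)) (at s within {0..T})"
        using comp[of i] unfolding has_field_derivative_def e inner_axis inner_real_def mult_1_right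
        by (rule has_derivative_eq_rhs) (simp add: fun_eq_iff mult_ac)
    qed
  qed
  have X: "(X has_vector_derivative vhat (V s)) (at s within {0..T})"
    using ch s by (auto simp: characteristic_def)
  have "((\<lambda>t. (t, X t, V t)) has_vector_derivative (1, vhat (V s), q *\<^sub>R axis 1 1)) (at s within {0..T})"
    by (intro has_vector_derivative_Pair X V has_vector_derivative_id[unfolded id_def])
  then have chain: "((\<lambda>t. f (t, X t, V t)) has_vector_derivative D (1, vhat (V s), q *\<^sub>R axis 1 1)) (at s within {0..T})"
    by (rule vector_derivative_diff_chain_within[unfolded o_def])
      (auto intro!: has_derivative_subset[OF D] simp: phase_spacetime_def)
  have lin: "linear D" using D has_derivative_linear by blast
  have "vhat (V s) = (\<Sum>i\<in>UNIV. (vhat (V s) $ i) *\<^sub>R axis i 1)"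
    by (simp add: vec_eq_iff axis_def if_distrib sum.If_cases)
  then have split: "(1, vhat (V s), q *\<^sub>R axis 1 1) = (1, 0, 0) +
      (\<Sum>i\<in>UNIV. (vhat (V s) $ i) *\<^sub>R (0, axis i 1, 0)) + q *\<^sub>R (0, 0, axis 1 1)"
    by (simp add: sum_3)
  have "D (1, vhat (V s), q *\<^sub>R axis 1 1) = D (1, 0, 0) +
      (\<Sum>i\<in>UNIV. (vhat (V s) $ i) *\<^sub>R D (0, axis i 1, 0)) + q *\<^sub>R D (0, 0, axis 1 1)"
    unfolding split by (simp only: linear_add[OF lin] linear_sum[OF lin] linear_scale[OF lin])
  also have "\<dots> = 0"
    using sol s unfolding solution_def D_def q_def pd_def by auto
  finally show "((\<lambda>t. f (t, X t, V t)) has_real_derivative 0) (at s within {0..T})"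
    using chain by (simp add: has_real_derivative_iff_has_vector_derivative)
qed (use t in auto)

text \<open>The stability error \<open>C * \<epsilon>\<close> may cost at most half of the lower bound \<open>\<Lambda> / 8\<close> for the
  homogeneous wave, which leaves the rate \<open>\<Lambda> / 16\<close> for the field. The extra exponent \<open>\<Lambda> / 32\<close> that
  \<open>momentum_growth\<close> then yields is raised to the power \<open>b\<close> by the weight.\<close>
lemma weighted_density_growth:
  assumes a: "profile a" and \<Lambda>: "0 < \<Lambda>" and sol: "solution f A"
    and stable: "stability a \<Lambda> \<epsilon> C A" and small: "C * \<epsilon> \<le> \<Lambda> / 16"
    and b: "0 < b" and W: "W \<in> weight_class b" and \<tau>: "1 \<le> \<tau>"
    and ch: "characteristic A \<tau> X V"
    and X0: "X 0 = vector [7, 0, 0]" and V0: "V 0 = vector [\<tau>, 0, 0]"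
  shows "jap \<tau> powr (2 * b * (1 / 64) * \<Lambda>) * W (jap \<tau>)
      * \<bar>f (0, vector [7, 0, 0], vector [\<tau>, 0, 0])\<bar>
    \<le> W (jap (V \<tau>)) * \<bar>f (\<tau>, X \<tau>, V \<tau>)\<bar>"
proof -
  have axis: "vector [y, 0, 0] = y *\<^sub>R (axis 1 1 :: real^3)" for y
    by (simp add: vec_eq_iff forall_3 axis_def)
  note on_axis = characteristic_on_axis[OF ch _ X0[unfolded axis] V0[unfolded axis]]
  have japV: "jap (V t) = jap (V t $ 1)" if "t \<in> {0..\<tau>}" for t
    using arg_cong[OF on_axis(2)[OF that], of norm] by (simp add: jap_def)
  have growth: "jap \<tau> powr (1 + (\<Lambda> / 16) / 2) \<le> jap (V \<tau> $ 1)"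
  proof (rule momentum_growth[where r = "\<lambda>t. X t $ 1" and E = "\<lambda>t. dx 1 A (t, X t)"])
    fix t assume t: "t \<in> {0..\<tau>}"
    have "((\<lambda>t. X t $ 1) has_real_derivative vhat (V t) $ 1) (at t within {0..\<tau>})"
      using ch t by (auto simp: characteristic_def has_real_derivative_iff_has_vector_derivative
          intro: bounded_linear.has_vector_derivative[OF bounded_linear_vec_nth])
    then show "((\<lambda>t. X t $ 1) has_real_derivative V t $ 1 / jap (V t $ 1)) (at t within {0..\<tau>})"
      using japV[OF t] by (simp add: vhat_def)
    show "((\<lambda>t. V t $ 1) has_real_derivative jap (V t $ 1) * dx 1 A (t, X t)) (at t within {0..\<tau>})"
      using ch t unfolding characteristic_def japV[OF t, symmetric] by auto
    assume near: "6 \<le> X t $ 1 - t" "X t $ 1 - t \<le> 7"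
    have Xt: "X t = (X t $ 1) *\<^sub>R axis 1 1" using on_axis(1)[OF t] .
    have "norm (X t) = \<bar>X t $ 1\<bar>" by (subst Xt) simp
    then have "norm (X t) = X t $ 1" using near t by simp
    then have stab: "jap t * \<bar>dx 1 A (t, X t) - \<Lambda> * dx 1 (A_hom a) (t, X t)\<bar> \<le> C * \<epsilon>"
      using stable t near by (auto simp: stability_def)
    have hom: "1 / 8 \<le> jap t * dx 1 (A_hom a) (t, X t)"
      using dx1_A_hom_lower_bound[OF a _ near] t Xt by simp
    have "\<Lambda> / 8 \<le> \<Lambda> * (jap t * dx 1 (A_hom a) (t, X t))"
      using mult_left_mono[OF hom, of \<Lambda>] \<Lambda> by simp
    moreover have "jap t * (\<Lambda> * dx 1 (A_hom a) (t, X t) - dx 1 A (t, X t)) \<le> C * \<epsilon>"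
      by (rule order_trans[OF mult_left_mono stab]) (use jap_pos[of t] in auto)
    ultimately show "\<Lambda> / 16 \<le> jap t * dx 1 A (t, X t)"
      using small by (simp add: algebra_simps)
  qed (use \<tau> \<Lambda> X0 V0 in auto)
  then have J: "jap \<tau> powr (1 + \<Lambda> / 32) \<le> jap (V \<tau>)" using japV[of \<tau>] \<tau> by simp
  have "jap \<tau> powr 1 \<le> jap \<tau> powr (1 + \<Lambda> / 32)"
    using \<Lambda> jap_ge_1[of \<tau>] by (intro powr_mono) auto
  then have le: "jap \<tau> \<le> jap (V \<tau>)" using J jap_pos[of \<tau>] by simp
  have "jap \<tau> powr (\<Lambda> / 32) \<le> jap (V \<tau>) / jap \<tau>"
    using J jap_pos[of \<tau>] by (simp add: powr_add pos_le_divide_eq mult.commute)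
  then have "(jap \<tau> powr (\<Lambda> / 32)) powr b \<le> (jap (V \<tau>) / jap \<tau>) powr b"
    using b by (intro powr_mono2) auto
  then have "jap \<tau> powr (2 * b * (1 / 64) * \<Lambda>) \<le> (jap (V \<tau>) / jap \<tau>) powr b"
    by (simp add: powr_powr mult_ac)
  moreover have "0 \<le> W (jap \<tau>)"
    using W jap_pos[of \<tau>] by (force simp: weight_class_def intro: order_trans[of 0 1])
  ultimately have "jap \<tau> powr (2 * b * (1 / 64) * \<Lambda>) * W (jap \<tau>) \<le> W (jap (V \<tau>))"
    using weight_growth[OF W jap_ge_1 le] by (meson mult_right_mono order_trans)
  moreover have "f (\<tau>, X \<tau>, V \<tau>) = f (0, vector [7, 0, 0], vector [\<tau>, 0, 0])"
    using density_constant_on_characteristic[OF sol ch, of \<tau>] \<tau> X0 V0 by simp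
  ultimately show "jap \<tau> powr (2 * b * (1 / 64) * \<Lambda>) * W (jap \<tau>)
      * \<bar>f (0, vector [7, 0, 0], vector [\<tau>, 0, 0])\<bar>
      \<le> W (jap (V \<tau>)) * \<bar>f (\<tau>, X \<tau>, V \<tau>)\<bar>"
    by (simp add: mult_right_mono)
qed

theorem proposition1p11:
  fixes a :: "real \<Rightarrow> real"
  assumes "profile a"
  shows "\<exists>c>0. \<forall>C_stab>0. \<exists>\<eta>>0.
    \<forall>(\<Lambda>::real) (\<epsilon>::real) (f0 :: (real^3) \<times> (real^3) \<Rightarrow> real) f A (\<kappa>::real) (B::real) (K_\<Lambda>::real) (K_f0::real).
      0 < \<Lambda> \<and> 0 < \<epsilon> \<and> 0 < K_\<Lambda> \<and> 0 < K_f0 \<and>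
      Ck_on 1 UNIV f0 \<and>
      solution f A \<and> initial_data a \<Lambda> \<epsilon> f0 f A \<and>
      in_framework a \<Lambda> \<epsilon> \<kappa> B (K_\<Lambda> * \<Lambda>) (K_f0 * \<epsilon>) C_stab f A \<and>
      \<epsilon> / \<Lambda> \<le> \<eta>
      \<longrightarrow>
      (\<forall>b>0. \<forall>W\<in>weight_class b. \<forall>\<tau>\<ge>1. \<forall>X V.
        characteristic A \<tau> X V \<and> X 0 = vector [7, 0, 0] \<and> V 0 = vector [\<tau>, 0, 0] \<longrightarrow>
        W (jap (V \<tau>)) * \<bar>f (\<tau>, X \<tau>, V \<tau>)\<bar>
          \<ge> jap \<tau> powr (2 * b * c * \<Lambda>) * W (jap \<tau>)
             * \<bar>f (0, vector [7, 0, 0], vector [\<tau>, 0, 0])\<bar>)"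
proof -
  have result: "jap \<tau> powr (2 * b * (1 / 64) * \<Lambda>) * W (jap \<tau>)
        * \<bar>f (0, vector [7, 0, 0], vector [\<tau>, 0, 0])\<bar>
      \<le> W (jap (V \<tau>)) * \<bar>f (\<tau>, X \<tau>, V \<tau>)\<bar>"
    if "0 < C" "0 < \<Lambda>" "\<epsilon> / \<Lambda> \<le> 1 / (16 * C)" "solution f A"
      "in_framework a \<Lambda> \<epsilon> \<kappa> B L e C f A" "0 < b" "W \<in> weight_class b" "1 \<le> \<tau>"
      "characteristic A \<tau> X V" "X 0 = vector [7, 0, 0]" "V 0 = vector [\<tau>, 0, 0]"
    for C \<Lambda> \<epsilon> f A \<kappa> B L e b W \<tau> X V
  proof (rule weighted_density_growth[OF assms])
    show "C * \<epsilon> \<le> \<Lambda> / 16" using that(1-3) by (simp add: field_simps)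
    show "stability a \<Lambda> \<epsilon> C A" using that(5) by (simp add: in_framework_def)
  qed (use that in simp_all)
  have \<eta>: "0 < 1 / (16 * C)" if "0 < C" for C :: real using that by simp
  show ?thesis
    apply (rule exI[of _ "1 / 64"], rule conjI, simp, intro allI impI)
    apply (rule_tac x = "1 / (16 * C_stab)" in exI, rule conjI, erule \<eta>)
    apply (intro allI impI ballI, elim conjE)
    by (rule result)
qed

end
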